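(* Let $X$ be a Banach space and $T:X\to X$ a continuous linear operator. The following conditions are equivalent: (i) there exist a sequence of numbers $(C_n)_{n\ge 1}$ with $C_n\to\infty$ and a sequence $(E_n)_{n\ge 1}$ of subspaces of $X$ of finite codimension such that for every $n\ge 1$, $\|T^n x\|\ge C_n\|x\|$ for any $x\in E_n$; (ii) there exist $C>1$, a subspace $E$ of $X$ of finite codimension and an integer $n\ge 1$ such that $\|T^n x\|\ge C\|x\|$ for any $x\in E$; (iii) there exist $C>1$, a subspace $E$ of $X$ of finite codimension and an integer $n\ge 1$ such that for any $x\in E$ there exists an integer $k$ with $0\le k\le n$ for which $\|T^k x\|\ge C\|x\|$.
   Context: Subspace means linear subspace (not required to be closed); a subspace $E\subset X$ has finite codimension if $X/E$ is a finite-dimensional vector space. Scalars are real or complex. *)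

theory Defs
  imports "HOL-Analysis.Analysis" "HOL-Library.Set_Algebras"
begin

text \<open>
  Banach spaces over the scalar field \<open>'k\<close>. The intended instances are \<open>real\<close> and \<open>complex\<close>; by the
  Gelfand--Mazur theorem every type of class \<open>real_normed_field\<close> (a commutative field containing
  the reals, with a multiplicative norm) is isometrically isomorphic to one of these two.
  The addition, norm, topology and completeness of the space come from the class \<open>banach\<close>;
  the scalar multiplication \<open>smul\<close> has to extend the built-in multiplication by reals.
\<close>

locale banach_space = vector_space smul
  for smul :: "'k::real_normed_field \<Rightarrow> 'a::banach \<Rightarrow> 'a" +
  assumes norm_smul: "norm (smul c x) = norm c * norm x"
    and smul_of_real: "smul (of_real r) x = r *\<^sub>R x"

definition quotient_carrier :: "'a::ab_group_add set \<Rightarrow> 'a set set" where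
  "quotient_carrier E = range (\<lambda>x. x +o E)"

text \<open>
  The vector space structure on the cosets of \<open>E\<close>: the zero is \<open>E\<close>, addition is the elementwise sum
  of sets, and \<open>c\<close> times \<open>x + E\<close> is \<open>c x + E\<close>. Adding \<open>E\<close> in the definition below matters only
  for \<open>c = 0\<close>, where the image of the coset is merely \<open>{0}\<close>.
\<close>

definition quotient_scale ::
    "('k \<Rightarrow> 'a \<Rightarrow> 'a) \<Rightarrow> 'a::ab_group_add set \<Rightarrow> 'k \<Rightarrow> 'a set \<Rightarrow> 'a set" where
  "quotient_scale smul E c A = smul c ` A + E"

inductive_set quotient_span ::
    "('k \<Rightarrow> 'a \<Rightarrow> 'a) \<Rightarrow> 'a::ab_group_add set \<Rightarrow> 'a set set \<Rightarrow> 'a set set"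
  for smul :: "'k \<Rightarrow> 'a::ab_group_add \<Rightarrow> 'a" and E :: "'a set" and S :: "'a set set" where
  zero: "E \<in> quotient_span smul E S"
| step: "A \<in> S \<Longrightarrow> Z \<in> quotient_span smul E S \<Longrightarrow>
    quotient_scale smul E c A + Z \<in> quotient_span smul E S"

definition finite_codim_subspace ::
    "('k::field \<Rightarrow> 'a \<Rightarrow> 'a) \<Rightarrow> 'a::ab_group_add set \<Rightarrow> bool" where
  "finite_codim_subspace smul E \<longleftrightarrow> module.subspace smul E \<and>
     (\<exists>S. finite S \<and> S \<subseteq> quotient_carrier E \<and> quotient_span smul E S = quotient_carrier E)"

end

theory Submission
  imports Defs
begin

text \<open>
  Iterating (iii) along an orbit whose first \<open>m + 1\<close> points lie in \<open>E\<close> yields a time \<open>k\<close> with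
  \<open>m \<le> k \<le> m + n\<close> at which the norm has grown by at least the factor \<open>C\<close> to the power \<open>m / n\<close>. Going back
  from time \<open>k\<close> to time \<open>m\<close> costs at most the factor \<open>M ^ n\<close>, where \<open>M \<ge> 1\<close> bounds the norm of \<open>T\<close>.
  The points whose first \<open>m + 1\<close> iterates lie in \<open>E\<close> form a subspace of finite codimension, so (i) holds.
\<close>

context vector_space
begin

section \<open>Finite codimension in terms of spanning sets\<close>

lemma span_Un_subspaceD:
  assumes "subspace E" "x \<in> span (E \<union> B)"
  shows "\<exists>e\<in>E. x - e \<in> span B"
proof -
  have "x \<in> (\<lambda>(a, b). a + b) ` (span E \<times> span B)"
    using assms(2) by (auto simp: span_Un)
  moreover have "span E = E" using assms(1) by simp
  ultimately obtain e b where "e \<in> E" "b \<in> span B" "x = e + b" by auto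
  then show ?thesis by (intro bexI[of _ e]) auto
qed

lemma quotient_scale_coset:
  assumes "subspace E"
  shows "quotient_scale scale E c (a +o E) = scale c a +o E"
proof -
  have 1: "scale c (a + e) + f = scale c a + (scale c e + f)" for e f
    by (simp add: scale_right_distrib add.assoc)
  show ?thesis
    unfolding quotient_scale_def
  proof (intro set_eqI iffI)
    fix x assume "x \<in> scale c ` (a +o E) + E"
    then obtain e f where "e \<in> E" "f \<in> E" "x = scale c (a + e) + f"
      by (auto simp: elt_set_plus_def elim!: set_plus_elim)
    then show "x \<in> scale c a +o E"
      using assms 1 by (auto simp: subspace_add subspace_scale)
  next
    fix x assume "x \<in> scale c a +o E"
    then obtain f where "f \<in> E" "x = scale c a + f"
      by (auto simp: elt_set_plus_def)
    moreover have "a \<in> a +o E"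
      using set_plus_intro2[OF subspace_0[OF assms], of a] by simp
    ultimately show "x \<in> scale c ` (a +o E) + E"
      by (auto intro: set_plus_intro)
  qed
qed

lemma coset_plus_coset:
  assumes "subspace E"
  shows "(a +o E) + (b +o E) = (a + b) +o E"
proof -
  have "E + E = E"
    using assms subspace_0[OF assms]
    by (auto simp: set_plus_def subspace_add) (metis add.right_neutral)
  then show ?thesis
    by (metis set_plus_rearrange)
qed

text \<open>Choosing one representative per coset turns finitely many generators of the quotient
  into the set \<open>B\<close>, and conversely the cosets of the vectors of \<open>B\<close>
  generate the quotient. From here on cosets no longer occur: codimension is handled by spans in the
  space itself.\<close>

lemma finite_codim_subspace_iff:
  "finite_codim_subspace scale E \<longleftrightarrow> subspace E \<and> (\<exists>B. finite B \<and> span (E \<union> B) = UNIV)"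
proof (intro iffI conjI)
  assume *: "finite_codim_subspace scale E"
  then show E: "subspace E" by (simp add: finite_codim_subspace_def)
  from * obtain S where S: "finite S" "S \<subseteq> range (\<lambda>x. x +o E)"
      "quotient_span scale E S = quotient_carrier E"
    by (auto simp: finite_codim_subspace_def quotient_carrier_def)
  then obtain B where B: "finite B" "S = (\<lambda>x. x +o E) ` B"
    by (meson finite_subset_image)
  \<comment> \<open>This suffices, because every vector lies in its own coset and every coset
    belongs to the quotient span.\<close>
  have "A \<subseteq> span (E \<union> B)" if "A \<in> quotient_span scale E S" for A
    using that
  proof induction
    case zero
    then show ?case by (auto intro: span_base)
  next
    case (step A Z c)
    then obtain b where b: "b \<in> B" "A = b +o E" using B by auto
    show ?case
    proof
      fix x assume "x \<in> quotient_scale scale E c A + Z"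
      then obtain e z where "e \<in> E" "z \<in> Z" "x = scale c b + e + z"
        unfolding b(2) quotient_scale_coset[OF E]
        by (auto simp: elt_set_plus_def elim!: set_plus_elim)
      with step.IH b(1) show "x \<in> span (E \<union> B)"
        by (auto intro!: span_add span_scale intro: span_base)
    qed
  qed
  moreover have "x +o E \<in> quotient_span scale E S" for x
    using S(3) by (auto simp: quotient_carrier_def)
  moreover have "x \<in> x +o E" for x
    using set_plus_intro2[OF subspace_0[OF E], of x] by simp
  ultimately have "span (E \<union> B) = UNIV" by blast
  with B show "\<exists>B. finite B \<and> span (E \<union> B) = UNIV" by blast
next
  assume *: "subspace E \<and> (\<exists>B. finite B \<and> span (E \<union> B) = UNIV)"
  then obtain B where E: "subspace E" and B: "finite B" "span (E \<union> B) = UNIV" by blast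
  define S where "S = (\<lambda>x. x +o E) ` B"
  have span: "u +o E \<in> quotient_span scale E S" if "u \<in> span B" for u
    using that
  proof (induction rule: span_induct_alt)
    case base
    then show ?case by (simp add: quotient_span.zero)
  next
    case (step c b y)
    have "quotient_scale scale E c (b +o E) + (y +o E) \<in> quotient_span scale E S"
      using step by (intro quotient_span.step) (auto simp: S_def)
    then show ?case by (simp add: quotient_scale_coset[OF E] coset_plus_coset[OF E])
  qed
  have "x +o E \<in> quotient_span scale E S" for x
  proof -
    have "x \<in> span (E \<union> B)" using B by simp
    then obtain e where e: "e \<in> E" "x - e \<in> span B"
      using span_Un_subspaceD[OF E] by blast
    \<comment> \<open>The summand \<open>e\<close> is absorbed by \<open>E\<close>, so
      \<open>x\<close> and \<open>x - e\<close> have the same coset, and \<open>x - e\<close> is a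
      combination of vectors of \<open>B\<close>.\<close>
    have "e +o E = E"
    proof (intro set_eqI iffI)
      fix y assume "y \<in> e +o E"
      then show "y \<in> E" using E e by (auto simp: elt_set_plus_def subspace_add)
    next
      fix y assume "y \<in> E"
      then have "y - e \<in> E" using E e by (simp add: subspace_diff)
      from set_plus_intro2[OF this, of e] show "y \<in> e +o E" by simp
    qed
    then have "x +o E = (x - e) +o E"
      by (metis diff_add_cancel set_plus_rearrange2)
    then show ?thesis using span[OF e(2)] by simp
  qed
  \<comment> \<open>The other inclusion: cosets are closed under the operations that generate the
    quotient span.\<close>
  moreover have "A \<in> quotient_carrier E" if "A \<in> quotient_span scale E S" for A
    using that
  proof induction
    case zero
    have "E = 0 +o E" by simp
    then show ?case unfolding quotient_carrier_def by (rule range_eqI)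
  next
    case (step A Z c)
    then obtain a z where "A = a +o E" "Z = z +o E"
      by (auto simp: S_def quotient_carrier_def)
    then show ?case
      by (auto simp: quotient_scale_coset[OF E] coset_plus_coset[OF E] quotient_carrier_def)
  qed
  ultimately have "quotient_span scale E S = quotient_carrier E"
    by (auto simp: quotient_carrier_def)
  moreover have "finite S" "S \<subseteq> quotient_carrier E"
    using B by (auto simp: S_def quotient_carrier_def)
  ultimately show "finite_codim_subspace scale E"
    using E unfolding finite_codim_subspace_def by blast
qed

section \<open>Finite codimension under preimages and along orbits\<close>

lemma subspace_Int_vimage:
  assumes "Vector_Spaces.linear scale scale f" "subspace S" "subspace F"
  shows "subspace (S \<inter> f -` F)"
proof -
  interpret f: Vector_Spaces.linear scale scale f by fact
  show ?thesis
    using assms(2,3) by (auto intro!: subspaceI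
      simp: f.zero f.add f.scale subspace_0 subspace_add subspace_scale)
qed

text \<open>
  Induction on \<open>B\<close>: enlarging \<open>F\<close> by one vector enlarges \<open>S \<inter> f -` F\<close> by at most one dimension.
\<close>

lemma finite_span_Int_vimage:
  assumes "Vector_Spaces.linear scale scale f" "finite B" "subspace S" "subspace F"
    and "f ` S \<subseteq> span (F \<union> B)"
  shows "\<exists>B'. finite B' \<and> S \<subseteq> span ((S \<inter> f -` F) \<union> B')"
  using assms(2,4,5)
proof (induction B arbitrary: F rule: finite_induct)
  case empty
  moreover have "span F = F" using empty by (simp only: span_eq_iff)
  ultimately have "S \<inter> f -` F = S" by auto
  then show ?case by (intro exI[of _ "{}"]) (simp add: span_superset)
next
  case (insert b B)
  interpret f: Vector_Spaces.linear scale scale f by fact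
  \<comment> \<open>Moving \<open>b\<close> from the generators into the subspace makes the
    induction hypothesis apply to \<open>F'\<close> and the smaller set \<open>B\<close>. What
    remains is to pass from \<open>F'\<close> back to \<open>F\<close>.\<close>
  define F' where "F' = span (insert b F)"
  have "span (F \<union> insert b B) \<subseteq> span (F' \<union> B)"
    by (rule span_minimal) (auto simp: F'_def intro: span_base)
  with insert.prems have "f ` S \<subseteq> span (F' \<union> B)" by blast
  with insert.IH[of F'] obtain B' where B': "finite B'" "S \<subseteq> span ((S \<inter> f -` F') \<union> B')"
    by (auto simp: F'_def)
  have F: "span F = F" using insert.prems(1) by (simp only: span_eq_iff)
  have decomp: "\<exists>k. y - scale k b \<in> F" if "y \<in> F'" for y
    using that by (simp add: F'_def span_insert F)
  obtain g where g: "S \<inter> f -` F' \<subseteq> span (insert g (S \<inter> f -` F))"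
  proof (cases "S \<inter> f -` F' \<subseteq> f -` F")
    case True
    \<comment> \<open>Nothing has to be added here; 0 is a dummy generator.\<close>
    then have "S \<inter> f -` F' \<subseteq> span (insert 0 (S \<inter> f -` F))" by (auto intro: span_base)
    then show ?thesis by (rule that)
  next
    case False
    then obtain g where g: "g \<in> S" "f g \<in> F'" "f g \<notin> F" by auto
    obtain c where c: "f g - scale c b \<in> F" using decomp g by blast
    \<comment> \<open>Otherwise \<open>f g\<close> would lie in \<open>F\<close>. So modulo
      \<open>F\<close> the vector \<open>f g\<close> is a nonzero multiple of \<open>b\<close>, and
      a suitable multiple of \<open>g\<close> cancels the \<open>b\<close> component of any
      \<open>f h\<close>.\<close>
    have "c \<noteq> 0" using c g by auto
    have "h \<in> span (insert g (S \<inter> f -` F))" if h: "h \<in> S" "f h \<in> F'" for h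
    proof -
      obtain d where d: "f h - scale d b \<in> F" using decomp h by blast
      have "(f h - scale d b) - scale (d / c) (f g - scale c b) \<in> F"
        using subspace_diff[OF insert.prems(1) d subspace_scale[OF insert.prems(1) c]] .
      then have "f (h - scale (d / c) g) \<in> F"
        using \<open>c \<noteq> 0\<close> by (simp add: f.diff f.scale scale_right_diff_distrib)
      then have "h - scale (d / c) g \<in> S \<inter> f -` F"
        using g h assms(3) by (simp add: subspace_diff subspace_scale)
      then show ?thesis
        unfolding span_insert by (auto intro: span_base)
    qed
    then show ?thesis by (intro that[of g]) auto
  qed
  have "span ((S \<inter> f -` F') \<union> B') \<subseteq> span ((S \<inter> f -` F) \<union> insert g B')"
  proof (rule span_minimal)
    have "span (insert g (S \<inter> f -` F)) \<subseteq> span ((S \<inter> f -` F) \<union> insert g B')"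
      by (rule span_mono) auto
    then show "(S \<inter> f -` F') \<union> B' \<subseteq> span ((S \<inter> f -` F) \<union> insert g B')"
      using g by (auto intro: span_base)
  qed simp
  with B' show ?case by (intro exI[of _ "insert g B'"]) auto
qed

text \<open>Finitely many vectors \<open>B'\<close> recover \<open>S\<close> from the intersection,
  and finitely many vectors \<open>A\<close> recover the whole space from \<open>S\<close>; their
  union does both.\<close>

lemma finite_codim_subspace_Int_vimage:
  assumes "Vector_Spaces.linear scale scale f"
    and "finite_codim_subspace scale S" "finite_codim_subspace scale F"
  shows "finite_codim_subspace scale (S \<inter> f -` F)"
proof -
  obtain A B where A: "finite A" "span (S \<union> A) = UNIV" and B: "finite B" "span (F \<union> B) = UNIV"
    and sub: "subspace S" "subspace F"
    using assms(2,3) by (auto simp: finite_codim_subspace_iff)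
  obtain B' where B': "finite B'" "S \<subseteq> span ((S \<inter> f -` F) \<union> B')"
    using finite_span_Int_vimage[OF assms(1) B(1) sub] B(2) by auto
  have "span (S \<union> A) \<subseteq> span ((S \<inter> f -` F) \<union> (B' \<union> A))"
  proof (rule span_minimal)
    have "span ((S \<inter> f -` F) \<union> B') \<subseteq> span ((S \<inter> f -` F) \<union> (B' \<union> A))"
      by (rule span_mono) auto
    then show "S \<union> A \<subseteq> span ((S \<inter> f -` F) \<union> (B' \<union> A))"
      using B' by (auto intro: span_base)
  qed simp
  with A B' subspace_Int_vimage[OF assms(1) sub] show ?thesis
    unfolding finite_codim_subspace_iff by (metis finite_UnI top.extremum_unique)
qed

text \<open>The first \<open>m + 2\<close> orbit points of \<open>x\<close> lie in \<open>E\<close>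
  exactly when \<open>x\<close> does and the first \<open>m + 1\<close> orbit points of
  \<open>f x\<close> do, so each step of the induction is one intersection with a preimage.\<close>

lemma finite_codim_subspace_orbit:
  assumes "Vector_Spaces.linear scale scale f" "finite_codim_subspace scale E"
  shows "finite_codim_subspace scale {x. \<forall>j\<le>m. (f ^^ j) x \<in> E}"
proof (induction m)
  case 0
  then show ?case using assms(2) by simp
next
  case (Suc m)
  have "{x. \<forall>j\<le>Suc m. (f ^^ j) x \<in> E} = E \<inter> f -` {x. \<forall>j\<le>m. (f ^^ j) x \<in> E}"
    by (auto simp: All_less_Suc2 funpow_swap1 simp flip: less_Suc_eq_le)
  then show ?case
    using finite_codim_subspace_Int_vimage[OF assms Suc] by simp
qed

end

section \<open>Norm bounds for the operator and its iterates\<close>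

lemma (in banach_space) continuous_linear_bounded:
  assumes "Vector_Spaces.linear smul smul T" "continuous_on UNIV T"
  shows "\<exists>M\<ge>1. \<forall>x. norm (T x) \<le> M * norm x"
proof -
  interpret T: Vector_Spaces.linear smul smul T by fact
  have scaleR: "T (r *\<^sub>R x) = r *\<^sub>R T x" for r x
    by (simp add: T.scale flip: smul_of_real)
  have "isCont T 0" using assms(2) by (simp add: continuous_on_eq_continuous_at)
  from this[unfolded continuous_at_eps_delta, rule_format, of 1]
  obtain d where d: "d > 0" "\<And>x. norm x < d \<Longrightarrow> norm (T x) < 1"
    by (auto simp: T.zero)
  have "norm (T x) \<le> (2 / d) * norm x" for x
  proof (cases "x = 0")
    case False
    \<comment> \<open>This factor brings \<open>x\<close> to norm \<open>d / 2\<close>, inside the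
      ball where \<open>T\<close> is bounded by 1.\<close>
    define r where "r = d / (2 * norm x)"
    have r: "r > 0" using d(1) False by (simp add: r_def)
    have "norm (r *\<^sub>R x) < d" using d(1) False by (simp add: r_def)
    then have "norm (T (r *\<^sub>R x)) < 1" by (rule d(2))
    then have "r * norm (T x) < 1" using r by (simp add: scaleR)
    then show ?thesis using d(1) False by (simp add: r_def field_simps)
  qed (simp add: T.zero)
  \<comment> \<open>A bound of at least 1 has increasing powers, which \<open>orbit_growth\<close>
    relies on.\<close>
  then have "norm (T x) \<le> max 1 (2 / d) * norm x" for x
    by (rule order_trans) (rule mult_right_mono; simp)
  then show ?thesis by (intro exI[of _ "max 1 (2 / d)"]) auto
qed

lemma norm_funpow_le:
  fixes T :: "'a::real_normed_vector \<Rightarrow> 'a" and M :: real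
  assumes "M \<ge> 0" "\<And>x. norm (T x) \<le> M * norm x"
  shows "norm ((T ^^ k) x) \<le> M ^ k * norm x"
proof (induction k)
  case (Suc k)
  have "norm ((T ^^ Suc k) x) \<le> M * norm ((T ^^ k) x)" using assms(2) by simp
  also have "\<dots> \<le> M * (M ^ k * norm x)" using Suc assms(1) by (rule mult_left_mono)
  finally show ?case by (simp add: mult.assoc)
qed simp

section \<open>Growth along orbits that stay in the subspace\<close>

text \<open>Jump from \<open>x\<close> to \<open>(T ^^ k) x\<close>, gaining a factor
  \<open>C\<close>, and repeat until time \<open>m\<close> is reached. Here \<open>j\<close> counts
  the jumps. Each has length at most \<open>n\<close>, so \<open>m \<le> n * j\<close>, and the last
  one overshoots \<open>m\<close> by at most \<open>n\<close>.\<close>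

lemma orbit_growth_time:
  fixes T :: "'a::real_normed_vector \<Rightarrow> 'a" and C :: real
  assumes "C > 1" "n \<ge> 1" "T 0 = 0"
    and step: "\<And>x. x \<in> E \<Longrightarrow> \<exists>k\<le>n. norm ((T ^^ k) x) \<ge> C * norm x"
    and "\<forall>j\<le>m. (T ^^ j) x \<in> E"
  shows "\<exists>k j. m \<le> k \<and> k \<le> m + n \<and> m \<le> n * j \<and> norm ((T ^^ k) x) \<ge> C ^ j * norm x"
  using assms(5)
proof (induction m arbitrary: x rule: less_induct)
  case (less m)
  have "(T ^^ 0) x \<in> E" using less.prems by blast
  then obtain k where k: "k \<le> n" "norm ((T ^^ k) x) \<ge> C * norm x" using step by auto
  \<comment> \<open>The zero vector is set apart because \<open>k = 0\<close> is possible for it,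
    and the jump would then make no progress.\<close>
  consider "x = 0" | "m \<le> k" | "x \<noteq> 0" "k < m" by linarith
  then show ?case
  proof cases
    case 1
    then show ?thesis using \<open>n \<ge> 1\<close> by (intro exI[of _ m]) auto
  next
    case 2
    then show ?thesis using k by (intro exI[of _ k] exI[of _ 1]) auto
  next
    case 3
    have "k \<noteq> 0"
    proof
      assume "k = 0"
      then have "C * norm x \<le> 1 * norm x" using k(2) by simp
      then show False using \<open>C > 1\<close> 3 by (simp only: mult_le_cancel_right) simp
    qed
    have "\<forall>j\<le>m - k. (T ^^ j) ((T ^^ k) x) \<in> E"
    proof (intro allI impI)
      fix j assume "j \<le> m - k"
      then have "(T ^^ (j + k)) x \<in> E" using less.prems 3 by auto
      then show "(T ^^ j) ((T ^^ k) x) \<in> E" by (simp add: funpow_add)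
    qed
    with less.IH[of "m - k" "(T ^^ k) x"] \<open>k \<noteq> 0\<close> 3 obtain k' j where
      k': "m - k \<le> k'" "k' \<le> m - k + n" "m - k \<le> n * j"
        "C ^ j * norm ((T ^^ k) x) \<le> norm ((T ^^ k') ((T ^^ k) x))"
      by auto
    have "C ^ Suc j * norm x = C ^ j * (C * norm x)" by simp
    also have "\<dots> \<le> C ^ j * norm ((T ^^ k) x)"
      using k(2) \<open>C > 1\<close> by (intro mult_left_mono) auto
    also have "\<dots> \<le> norm ((T ^^ (k' + k)) x)" using k'(4) by (simp add: funpow_add)
    finally show ?thesis
      using k(1) k' 3 by (intro exI[of _ "k' + k"] exI[of _ "Suc j"]) auto
  qed
qed

lemma orbit_growth:
  fixes T :: "'a::real_normed_vector \<Rightarrow> 'a" and C M :: real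
  assumes "C > 1" "n \<ge> 1" "T 0 = 0"
    and "\<And>x. x \<in> E \<Longrightarrow> \<exists>k\<le>n. norm ((T ^^ k) x) \<ge> C * norm x"
    and "\<forall>j\<le>m. (T ^^ j) x \<in> E"
    and M: "M \<ge> 1" "\<And>x. norm (T x) \<le> M * norm x"
  shows "norm ((T ^^ m) x) \<ge> root n C ^ m / M ^ n * norm x"
proof -
  obtain k j where k: "m \<le> k" "k \<le> m + n" "m \<le> n * j" "norm ((T ^^ k) x) \<ge> C ^ j * norm x"
    using orbit_growth_time[of C n T E m x] assms(1-5) by blast
  \<comment> \<open>The number of jumps depends on \<open>x\<close>; bounding \<open>C ^ j\<close>
    from below by a power of the n-th root of \<open>C\<close> leaves a factor that depends on
    \<open>m\<close> only.\<close>
  have "root n C ^ m \<le> root n C ^ (n * j)"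
    using k(3) assms(1,2) by (intro power_increasing) auto
  also have "\<dots> = C ^ j" using assms(1,2) by (simp add: power_mult)
  finally have "root n C ^ m * norm x \<le> C ^ j * norm x" by (simp add: mult_right_mono)
  also have "\<dots> \<le> norm ((T ^^ k) x)" by (fact k(4))
  also have "\<dots> = norm ((T ^^ (k - m)) ((T ^^ m) x))"
    using k(1) by (simp flip: funpow_add comp_apply[of "T ^^ (k - m)"])
  also have "\<dots> \<le> M ^ (k - m) * norm ((T ^^ m) x)"
    using M by (intro norm_funpow_le) auto
  \<comment> \<open>The overshoot \<open>k - m\<close> also varies with \<open>x\<close>, but it is
    at most \<open>n\<close>.\<close>
  also have "\<dots> \<le> M ^ n * norm ((T ^^ m) x)"
    using M k(2) by (intro mult_right_mono power_increasing) auto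
  finally show ?thesis using M(1) by (simp add: field_simps)
qed

section \<open>Equivalence of the three conditions\<close>

theorem theorem0p5:
  fixes smul :: "'k::real_normed_field \<Rightarrow> 'a::banach \<Rightarrow> 'a" and T :: "'a \<Rightarrow> 'a"
  assumes "banach_space smul"
    and "Vector_Spaces.linear smul smul T"
    and "continuous_on UNIV T"
  shows
    "((\<exists>(C :: nat \<Rightarrow> real) (E :: nat \<Rightarrow> 'a set).
         filterlim C at_top sequentially \<and>
         (\<forall>n\<ge>1. finite_codim_subspace smul (E n) \<and>
            (\<forall>x\<in>E n. norm ((T ^^ n) x) \<ge> C n * norm x)))
      \<longleftrightarrow>
      (\<exists>(C :: real) (E :: 'a set) (n :: nat).
         C > 1 \<and> finite_codim_subspace smul E \<and> n \<ge> 1 \<and>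
         (\<forall>x\<in>E. norm ((T ^^ n) x) \<ge> C * norm x)))
     \<and>
     ((\<exists>(C :: real) (E :: 'a set) (n :: nat).
         C > 1 \<and> finite_codim_subspace smul E \<and> n \<ge> 1 \<and>
         (\<forall>x\<in>E. norm ((T ^^ n) x) \<ge> C * norm x))
      \<longleftrightarrow>
      (\<exists>(C :: real) (E :: 'a set) (n :: nat).
         C > 1 \<and> finite_codim_subspace smul E \<and> n \<ge> 1 \<and>
         (\<forall>x\<in>E. \<exists>k\<le>n. norm ((T ^^ k) x) \<ge> C * norm x)))"
    (is "(?i \<longleftrightarrow> ?ii) \<and> (?ii \<longleftrightarrow> ?iii)")
proof -
  interpret banach_space smul by fact
  interpret T: Vector_Spaces.linear smul smul T by fact
  have "?ii" if "?i"
  proof -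
    from that obtain C E where C: "filterlim C at_top sequentially"
      and E: "\<forall>n\<ge>1. finite_codim_subspace smul (E n) \<and> (\<forall>x\<in>E n. norm ((T ^^ n) x) \<ge> C n * norm x)"
      by blast
    have "eventually (\<lambda>n. C n > 1 \<and> n \<ge> 1) sequentially"
      using C by (intro eventually_conj eventually_ge_at_top) (simp add: filterlim_at_top_dense)
    then obtain n where "C n > 1" "n \<ge> 1"
      using eventually_happens' sequentially_bot by blast
    with E show ?thesis by blast
  qed
  \<comment> \<open>Take \<open>k = n\<close> for every \<open>x\<close>.\<close>
  moreover have "?iii" if "?ii"
    using that by blast
  moreover have "?i" if "?iii"
  proof -
    from that obtain C E n where C: "C > 1" and E: "finite_codim_subspace smul E" and n: "n \<ge> 1"
      and step: "\<And>x. x \<in> E \<Longrightarrow> \<exists>k\<le>n. norm ((T ^^ k) x) \<ge> C * norm x"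
      by blast
    obtain M where M: "M \<ge> 1" "\<And>x. norm (T x) \<le> M * norm x"
      using continuous_linear_bounded assms(2,3) by blast
    \<comment> \<open>The root exceeds 1 because \<open>C\<close> does. The divisor
      \<open>M ^ n\<close> is positive and independent of \<open>m\<close>, so the quotients diverge
      too and serve as the constants in (i).\<close>
    have "filterlim (\<lambda>m. root n C ^ m) at_top sequentially"
      using C n by (intro filterlim_at_infinity_imp_filterlim_at_top
          filterlim_realpow_sequentially_gt1) auto
    then have "filterlim (\<lambda>m. root n C ^ m / M ^ n) at_top sequentially"
      using M(1) filterlim_tendsto_pos_mult_at_top[OF tendsto_const, of "1 / M ^ n"] by simp
    moreover have "finite_codim_subspace smul {x. \<forall>j\<le>m. (T ^^ j) x \<in> E}" for m
      using assms(2) E by (rule finite_codim_subspace_orbit)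
    moreover have "norm ((T ^^ m) x) \<ge> root n C ^ m / M ^ n * norm x"
      if "x \<in> {x. \<forall>j\<le>m. (T ^^ j) x \<in> E}" for m x
      using that by (intro orbit_growth[of C n T E] C n T.zero step M) auto
    ultimately show ?thesis
      by (intro exI[of _ "\<lambda>m. root n C ^ m / M ^ n"]
          exI[of _ "\<lambda>m. {x. \<forall>j\<le>m. (T ^^ j) x \<in> E}"]) blast
  qed
  ultimately show ?thesis by argo
qed

end
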